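(* Let $n \ge 1$ be an integer. (1) For any positive real values $\{\omega_i^{(k)}\}_{i,k=1}^n$, with geometric means $$\omega_i^* = \left(\prod_{k=1}^n \omega_i^{(k)}\right)^{1/n},\quad i=1,\dots,n,$$ and any real $C>0$, there exists a unique $n\times n$ positive matrix $A=\|a_{ik}\|$ such that $$\omega_i^* = C\left(\prod_{k=1}^n a_{ik}\right)^{1/n},\qquad \omega_i^{(k)} = \frac{1}{\lambda}\, a_{ik}\,\omega_k^*,\qquad i,k=1,\dots,n,\qquad \text{where } \lambda=\left(\prod_{i,r=1}^n a_{ir}\right)^{1/n^2}. \quad ( * )$$ (2) Conversely, for any $n\times n$ positive matrix $A=\|a_{ik}\|$ and any positive constant $C$, there exist unique positive real values $\{\omega_i^{(k)}\}_{i,k=1}^n$ such that, with their geometric means $\omega_i^* = \left(\prod_{k=1}^n \omega_i^{(k)}\right)^{1/n}$, $i=1,\dots,n$, the relations $( * )$ hold.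
   Context: A positive matrix is a real matrix all of whose entries are strictly positive; it is not assumed to be reciprocal or symmetric. All roots are positive real roots of positive real numbers. The index $k$ in $\omega_i^{(k)}$ is a superscript label (the $k$-th measurement of the $i$-th element), not an exponent or derivative. *)

theory Defs
  imports "HOL-Analysis.Analysis"
begin

definition positive_matrix :: "real^'n^'m \<Rightarrow> bool" where
  "positive_matrix A \<longleftrightarrow> (\<forall>i k. A $ i $ k > 0)"

text \<open>The index type \<open>'n\<close> plays the role of \<open>{1..n}\<close> with \<open>n = CARD('n) \<ge> 1\<close>. For a family
  of measurements, \<open>\<omega> i k\<close> is the \<open>k\<close>-th measurement of the \<open>i\<close>-th element.\<close>

definition geo_mean :: "('n::finite \<Rightarrow> real) \<Rightarrow> real" where
  "geo_mean x = root (CARD('n)) (\<Prod>k\<in>UNIV. x k)"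

definition matrix_geo_mean :: "real^'n^'n \<Rightarrow> real" where
  "matrix_geo_mean A = root (CARD('n)\<^sup>2) (\<Prod>i\<in>UNIV. \<Prod>r\<in>UNIV. A $ i $ r)"

definition measurement_relations :: "real \<Rightarrow> ('n::finite \<Rightarrow> 'n \<Rightarrow> real) \<Rightarrow> real^'n^'n \<Rightarrow> bool" where
  "measurement_relations C \<omega> A \<longleftrightarrow>
     (\<forall>i. geo_mean (\<omega> i) = C * geo_mean (\<lambda>k. A $ i $ k)) \<and>
     (\<forall>i k. \<omega> i k = 1 / matrix_geo_mean A * A $ i $ k * geo_mean (\<omega> k))"

end

theory Submission
  imports Defs
begin

text \<open>
  Write \<open>G\<close> for the geometric mean of a family indexed by \<open>'n\<close>. Everything rests on two facts:
  \<open>G\<close> is multiplicative, and \<open>\<lambda> = matrix_geo_mean A\<close> is the geometric mean of the geometric means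
  \<open>G (A\<^sub>i)\<close> of the rows of \<open>A\<close>. Let \<open>\<omega>\<^sub>i\<^sup>* = G (\<omega>\<^sub>i)\<close> and let \<open>W\<close> be the geometric mean of the
  \<open>\<omega>\<^sub>i\<^sup>*\<close>.

  When \<open>\<omega>\<close> is given, averaging the first relation \<open>\<omega>\<^sub>i\<^sup>* = C * G (A\<^sub>i)\<close> over \<open>i\<close> gives \<open>W = C * \<lambda>\<close>.
  So \<open>\<lambda>\<close> is already determined by \<open>\<omega>\<close> and \<open>C\<close>, and the second relation can be solved for the
  entries of \<open>A\<close>. When \<open>A\<close> is given, the first relation determines each \<open>\<omega>\<^sub>i\<^sup>*\<close>, and then the second
  one determines \<open>\<omega>\<close>. In both directions, multiplicativity of \<open>G\<close> shows that the candidate so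
  obtained does satisfy the two relations. Hence the system is equivalent to an explicit formula
  for either unknown (lemmas \<open>measurement_relations_iff_matrix\<close> and
  \<open>measurement_relations_iff_measurements\<close>), and existence and uniqueness follow.
\<close>

lemma real_root_prod:
  fixes f :: "'a \<Rightarrow> real"
  assumes "n > 0"
  shows "root n (\<Prod>i\<in>I. f i) = (\<Prod>i\<in>I. root n (f i))"
  using assms by (induction I rule: infinite_finite_induct) (simp_all add: real_root_mult)

lemma geo_mean_mult: "geo_mean (\<lambda>k. x k * y k) = geo_mean x * geo_mean y"
  by (simp add: geo_mean_def prod.distrib real_root_mult)

lemma geo_mean_divide: "geo_mean (\<lambda>k. x k / y k) = geo_mean x / geo_mean y"
  by (simp add: geo_mean_def prod_dividef real_root_divide)

lemma geo_mean_const: "c \<ge> 0 \<Longrightarrow> geo_mean (\<lambda>_. c) = c"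
  by (simp add: geo_mean_def real_root_power_cancel)

lemma geo_mean_pos: "(\<And>k. x k > 0) \<Longrightarrow> geo_mean x > 0"
  by (simp add: geo_mean_def prod_pos)

lemma matrix_geo_mean_eq: "matrix_geo_mean A = geo_mean (\<lambda>i. geo_mean (\<lambda>k. A $ i $ k))"
  by (simp add: matrix_geo_mean_def geo_mean_def power2_eq_square real_root_mult_exp real_root_prod)

text \<open>
  Averaging the first relation over \<open>i\<close> gives \<open>\<lambda> = W / C\<close>, which eliminates the only term of the
  second relation that couples all entries of \<open>A\<close>. Conversely, for the matrix on the right the
  factors \<open>W\<close> cancel in the row means, leaving \<open>G (A\<^sub>i) = \<omega>\<^sub>i\<^sup>* / C\<close>.
\<close>

lemma measurement_relations_iff_matrix:
  fixes \<omega> :: "'n::finite \<Rightarrow> 'n \<Rightarrow> real" and A :: "real^'n^'n"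
  assumes \<omega>: "\<And>i k. \<omega> i k > 0" and C: "C > 0"
  shows "measurement_relations C \<omega> A \<longleftrightarrow>
    A = (\<chi> i k. geo_mean (\<lambda>j. geo_mean (\<omega> j)) / C * (\<omega> i k / geo_mean (\<omega> k)))"
    (is "_ \<longleftrightarrow> A = ?B")
proof -
  define W where "W = geo_mean (\<lambda>j. geo_mean (\<omega> j))"
  have star: "geo_mean (\<omega> i) > 0" for i
    by (intro geo_mean_pos \<omega>)
  have W: "W > 0"
    unfolding W_def by (intro geo_mean_pos star)
  show ?thesis
  proof
    assume rel: "measurement_relations C \<omega> A"
    have "W = geo_mean (\<lambda>i. C * geo_mean (\<lambda>k. A $ i $ k))"
      using rel by (simp add: W_def measurement_relations_def)
    also have "\<dots> = C * matrix_geo_mean A"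
      using C by (simp add: geo_mean_mult geo_mean_const matrix_geo_mean_eq)
    finally have lam: "matrix_geo_mean A = W / C"
      using C by simp
    have "A $ i $ k = W / C * (\<omega> i k / geo_mean (\<omega> k))" for i k
    proof -
      have "\<omega> i k = 1 / (W / C) * A $ i $ k * geo_mean (\<omega> k)"
        using rel unfolding measurement_relations_def lam by blast
      then show ?thesis
        using W C star[of k] by (simp add: field_simps)
    qed
    then show "A = ?B"
      by (simp add: vec_eq_iff W_def)
  next
    assume "A = ?B"
    then have A: "A $ i $ k = W / C * (\<omega> i k / geo_mean (\<omega> k))" for i k
      by (simp add: W_def)
    have row: "geo_mean (\<lambda>k. A $ i $ k) = geo_mean (\<omega> i) / C" for i
    proof -
      have "geo_mean (\<lambda>k. A $ i $ k) = W / C * (geo_mean (\<omega> i) / W)"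
        unfolding A geo_mean_mult geo_mean_divide using W C by (simp add: geo_mean_const W_def)
      then show ?thesis
        using W by simp
    qed
    have lam: "matrix_geo_mean A = W / C"
      using C by (simp add: matrix_geo_mean_eq row geo_mean_divide geo_mean_const W_def)
    show "measurement_relations C \<omega> A"
      unfolding measurement_relations_def row lam A
      using W C star by (auto simp: field_simps less_imp_neq[symmetric])
  qed
qed

text \<open>
  The formula on the right is the second relation with \<open>\<omega>\<^sub>k\<^sup>*\<close> replaced through the first. That it
  satisfies the first relation is a cancellation: averaging \<open>C * G (A\<^sub>k)\<close> over \<open>k\<close> produces
  \<open>C * \<lambda>\<close>, which removes the factor \<open>1 / \<lambda>\<close>.
\<close>

lemma measurement_relations_iff_measurements:
  fixes \<omega> :: "'n::finite \<Rightarrow> 'n \<Rightarrow> real" and A :: "real^'n^'n"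
  assumes A: "positive_matrix A" and C: "C > 0"
  shows "measurement_relations C \<omega> A \<longleftrightarrow>
    \<omega> = (\<lambda>i k. A $ i $ k / matrix_geo_mean A * (C * geo_mean (\<lambda>j. A $ k $ j)))"
    (is "_ \<longleftrightarrow> \<omega> = ?w")
proof
  assume "measurement_relations C \<omega> A"
  then show "\<omega> = ?w"
    by (simp add: measurement_relations_def fun_eq_iff)
next
  assume w: "\<omega> = ?w"
  have lam: "matrix_geo_mean A > 0"
    unfolding matrix_geo_mean_eq using A by (intro geo_mean_pos) (simp add: positive_matrix_def)
  have star: "geo_mean (\<omega> i) = C * geo_mean (\<lambda>k. A $ i $ k)" for i
  proof -
    have "geo_mean (\<omega> i) =
        geo_mean (\<lambda>k. A $ i $ k) / matrix_geo_mean A * (C * matrix_geo_mean A)"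
      unfolding w geo_mean_mult geo_mean_divide
      using C lam by (simp add: geo_mean_const flip: matrix_geo_mean_eq)
    then show ?thesis
      using lam by simp
  qed
  show "measurement_relations C \<omega> A"
    unfolding measurement_relations_def star by (simp add: w)
qed

theorem mainTheorem1:
  shows "(\<forall>(\<omega> :: 'n::finite \<Rightarrow> 'n \<Rightarrow> real) (C :: real).
            (\<forall>i k. \<omega> i k > 0) \<and> C > 0 \<longrightarrow>
            (\<exists>!A :: real^'n^'n. positive_matrix A \<and> measurement_relations C \<omega> A)) \<and>
         (\<forall>(A :: real^'n^'n) (C :: real).
            positive_matrix A \<and> C > 0 \<longrightarrow>
            (\<exists>!\<omega> :: 'n \<Rightarrow> 'n \<Rightarrow> real. (\<forall>i k. \<omega> i k > 0) \<and> measurement_relations C \<omega> A))"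
proof (intro conjI allI impI; elim conjE)
  fix \<omega> :: "'n \<Rightarrow> 'n \<Rightarrow> real" and C :: real
  assume \<omega>: "\<forall>i k. \<omega> i k > 0" and C: "C > 0"
  let ?B = "\<chi> i k. geo_mean (\<lambda>j. geo_mean (\<omega> j)) / C * (\<omega> i k / geo_mean (\<omega> k))"
  have "positive_matrix ?B"
    using \<omega> C by (simp add: positive_matrix_def geo_mean_pos)
  moreover have "measurement_relations C \<omega> A \<longleftrightarrow> A = ?B" for A
    using \<omega> C by (intro measurement_relations_iff_matrix) auto
  ultimately show "\<exists>!A :: real^'n^'n. positive_matrix A \<and> measurement_relations C \<omega> A"
    by (intro ex1I[of _ ?B]) simp_all
next
  fix A :: "real^'n^'n" and C :: real
  assume A: "positive_matrix A" and C: "C > 0"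
  let ?w = "\<lambda>i k. A $ i $ k / matrix_geo_mean A * (C * geo_mean (\<lambda>j. A $ k $ j))"
  have "\<forall>i k. ?w i k > 0"
    using A C by (simp add: positive_matrix_def matrix_geo_mean_eq geo_mean_pos)
  moreover have "measurement_relations C \<omega> A \<longleftrightarrow> \<omega> = ?w" for \<omega>
    by (intro measurement_relations_iff_measurements A C)
  ultimately show "\<exists>!\<omega> :: 'n \<Rightarrow> 'n \<Rightarrow> real. (\<forall>i k. \<omega> i k > 0) \<and> measurement_relations C \<omega> A"
    by (intro ex1I[of _ ?w]) simp_all
qed

end
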